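(* With $\mathcal{A}$, $\overline{\mathcal{A}}$, $\mathfrak{R}_1$, $\mathfrak{R}_3$, $\Omega_1$, $\Omega_2$ as defined in the context, and with $Z_P(-)$ denoting the Poisson centre: 1. $Z_P(\mathfrak{R}_1)=\mathbb{K}[\Omega_1^{\pm1},\Omega_2^{\pm1}]$. 2. $Z_P(\overline{\mathcal{A}})=\mathbb{K}[\Omega_1,\Omega_2]$. 3. $Z_P(\mathfrak{R}_3)=\mathbb{K}[\Omega_1,\Omega_2]$. 4. $Z_P(\mathcal{A})=\mathbb{K}[\Omega_1,\Omega_2]$.
   Context: $\mathbb{K}$ is a field of characteristic zero. The Poisson centre of a Poisson algebra $B$ is $Z_P(B)=\{a\in B\mid\{a,b\}=0\ \forall b\in B\}$. Poisson brackets extend uniquely to localizations. $\mathcal{A}=\mathbb{K}[X_1,\ldots,X_6]$ is the polynomial algebra with the Poisson bracket $\{X_2,X_1\}=-3X_1X_2$, $\{X_3,X_1\}=-X_1X_3-X_2$, $\{X_3,X_2\}=-3X_2X_3$, $\{X_4,X_1\}=-2X_3^2$, $\{X_4,X_2\}=-3X_2X_4-4X_3^3$, $\{X_4,X_3\}=-3X_3X_4$, $\{X_5,X_1\}=X_1X_5-2X_3$, $\{X_5,X_2\}=-6X_3^2$, $\{X_5,X_3\}=-X_3X_5-3X_4$, $\{X_5,X_4\}=-3X_4X_5$, $\{X_6,X_1\}=3X_1X_6-3X_5$, $\{X_6,X_2\}=3X_2X_6+9X_4-18X_3X_5$, $\{X_6,X_3\}=-6X_5^2$, $\{X_6,X_4\}=-3X_4X_6-4X_5^3$,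 $\{X_6,X_5\}=-3X_5X_6$. In the fraction field of $\mathcal{A}$ define $X_{1,6}=X_1-\frac12X_5X_6^{-1}$, $X_{2,6}=X_2+\frac32X_4X_6^{-1}-3X_3X_5X_6^{-1}+X_5^3X_6^{-2}$, $X_{3,6}=X_3-X_5^2X_6^{-1}$, $X_{4,6}=X_4-\frac23X_5^3X_6^{-1}$, $X_{5,6}=X_5$; $X_{1,5}=X_{1,6}-X_{3,6}X_{5,6}^{-1}+\frac34X_{4,6}X_{5,6}^{-2}$, $X_{2,5}=X_{2,6}-3X_{3,6}^2X_{5,6}^{-1}+\frac92X_{3,6}X_{4,6}X_{5,6}^{-2}-\frac94X_{4,6}^2X_{5,6}^{-3}$, $X_{3,5}=X_{3,6}-\frac32X_{4,6}X_{5,6}^{-1}$, $X_{4,5}=X_{4,6}$; $X_{1,4}=X_{1,5}-\frac13X_{3,5}^2X_{4,5}^{-1}$, $X_{2,4}=X_{2,5}-\frac23X_{3,5}^3X_{4,5}^{-1}$, $X_{3,4}=X_{3,5}$; $X_{1,3}=X_{1,4}-\frac12X_{2,4}X_{3,4}^{-1}$; and $T_1=X_{1,3}$, $T_2=X_{2,4}$, $T_3=X_{3,5}$, $T_4=X_{4,6}$, $T_5=X_5$, $T_6=X_6$. $\overline{\mathcal{A}}=\mathbb{K}[T_1,\ldots,T_6]$ is a polynomial algebra, and a Poisson affine space: $\{T_i,T_j\}=\mu_{ij}T_iT_j$ with $(\mu_{ij})$ the skew-symmetric matrix with upper entries $\mu_{12}=3,\mu_{13}=1,\mu_{14}=0,\mu_{15}=-1,\mu_{16}=-3,\mu_{23}=3,\mu_{24}=3,\mu_{25}=0,\mu_{26}=-3,\mu_{34}=3,\mu_{35}=1,\mu_{36}=0,\mu_{45}=3,\mu_{46}=3,\mu_{56}=3$.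 $\mathfrak{R}_1=\mathbb{K}[T_1^{\pm1},\ldots,T_6^{\pm1}]$ and $\mathfrak{R}_3=\mathbb{K}[T_1,T_2,T_3^{\pm1},T_4^{\pm1},T_5^{\pm1},T_6^{\pm1}]$ (the localization of $\overline{\mathcal{A}}$ at the monomials in $T_3,\ldots,T_6$), with the extended brackets. $\Omega_1:=T_1T_3T_5=X_1X_3X_5-\frac32X_1X_4-\frac12X_2X_5+\frac12X_3^2$ and $\Omega_2:=T_2T_4T_6=X_2X_4X_6-\frac23X_3^3X_6-\frac23X_2X_5^3+2X_3^2X_5^2-3X_3X_4X_5+\frac32X_4^2$. *)

theory Defs
  imports
    "HOL-Library.Poly_Mapping"
    "HOL-Library.Numeral_Type"
    "HOL-Computational_Algebra.Polynomial_Factorial"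
begin

section \<open>Polynomials and rational functions in six variables\<close>

text \<open>
  The index type \<open>6\<close> consists of the residues modulo 6, so \<open>6 = 0\<close> in it and
  its elements are exactly \<open>1, 2, 3, 4, 5, 6\<close>. Monomials are exponent vectors
  \<open>6 \<Rightarrow>\<^sub>0 nat\<close>, and multiplication of polynomials is the convolution product of
  \<^theory>\<open>HOL-Library.Poly_Mapping\<close>. All the algebras considered
  live inside the fraction field \<open>'k ratfun6\<close> of \<open>'k poly6\<close>.
\<close>

type_synonym 'k poly6 = "(6 \<Rightarrow>\<^sub>0 nat) \<Rightarrow>\<^sub>0 'k"
type_synonym 'k ratfun6 = "'k poly6 fract"

definition const :: "'k::field_char_0 \<Rightarrow> 'k ratfun6" where
  "const c = to_fract (Poly_Mapping.single 0 c)"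

definition X :: "6 \<Rightarrow> 'k::field_char_0 ratfun6" where
  "X i = to_fract (Poly_Mapping.single (Poly_Mapping.single i 1) 1)"

text \<open>The \<open>'k\<close>-subalgebra generated by \<open>S\<close>; it is closed under negation since \<open>const (- 1)\<close> is in it.\<close>

inductive_set subalg :: "'k::field_char_0 ratfun6 set \<Rightarrow> 'k ratfun6 set"
  for S :: "'k ratfun6 set" where
  const: "const c \<in> subalg S"
| gen: "f \<in> S \<Longrightarrow> f \<in> subalg S"
| add: "f \<in> subalg S \<Longrightarrow> g \<in> subalg S \<Longrightarrow> f + g \<in> subalg S"
| mult: "f \<in> subalg S \<Longrightarrow> g \<in> subalg S \<Longrightarrow> f * g \<in> subalg S"


section \<open>Partial derivatives\<close>

definition pd :: "6 \<Rightarrow> 'k::field_char_0 poly6 \<Rightarrow> 'k poly6" where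
  "pd i p = (\<Sum>m\<in>Poly_Mapping.keys p. Poly_Mapping.single (m - Poly_Mapping.single i 1)
      (of_nat (Poly_Mapping.lookup m i) * Poly_Mapping.lookup p m))"

lemma pd_superset:
  assumes "finite S" "Poly_Mapping.keys p \<subseteq> S"
  shows "pd i p = (\<Sum>m\<in>S. Poly_Mapping.single (m - Poly_Mapping.single i 1)
      (of_nat (Poly_Mapping.lookup m i) * Poly_Mapping.lookup p m))"
  unfolding pd_def
  by (rule sum.mono_neutral_left) (use assms in \<open>auto simp: in_keys_iff\<close>)

lemma pd_add: "pd i (p + q) = pd i p + pd i q"
proof -
  let ?S = "Poly_Mapping.keys p \<union> Poly_Mapping.keys q"
  have "Poly_Mapping.keys (p + q) \<subseteq> ?S" by (rule Poly_Mapping.keys_add)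
  then show ?thesis
    by (simp add: pd_superset[of ?S] lookup_add algebra_simps single_add sum.distrib)
qed

lemma pd_0 [simp]: "pd i 0 = 0"
  by (simp add: pd_def)

lemma pd_single: "pd i (Poly_Mapping.single m c) =
    Poly_Mapping.single (m - Poly_Mapping.single i 1) (of_nat (Poly_Mapping.lookup m i) * c)"
  by (subst pd_superset[of "{m}"]) auto

lemma poly6_induct [case_names single add]:
  assumes "\<And>m c. P (Poly_Mapping.single m c)" and "\<And>p q. P p \<Longrightarrow> P q \<Longrightarrow> P (p + q)"
  shows "P (p :: 'k::field_char_0 poly6)"
proof (induction p rule: update_induct)
  case const
  show ?case using assms(1)[of 0 0] by simp
next
  case (update p a b)
  then have "Poly_Mapping.update a b p = p + Poly_Mapping.single a b"
    by (intro poly_mapping_eqI)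
      (auto simp: lookup_update lookup_add lookup_single when_def in_keys_iff)
  then show ?case using assms update by simp
qed

lemma pd_mult_single:
  "pd i (Poly_Mapping.single m c * Poly_Mapping.single n d) =
   pd i (Poly_Mapping.single m c) * Poly_Mapping.single n d +
   Poly_Mapping.single m c * pd i (Poly_Mapping.single n (d::'k::field_char_0))"
proof -
  let ?e = "Poly_Mapping.single i 1 :: 6 \<Rightarrow>\<^sub>0 nat"
  have A: "m + n - ?e = m - ?e + n" if "Poly_Mapping.lookup m i \<noteq> 0" for m n
    using that by (intro poly_mapping_eqI) (auto simp: lookup_add lookup_minus lookup_single when_def)
  have B: "m + n - ?e = m + (n - ?e)" if "Poly_Mapping.lookup n i \<noteq> 0"
    using A[OF that, of m] by (simp add: add.commute)
  have "Poly_Mapping.single (m + n - ?e) (of_nat (Poly_Mapping.lookup m i) * c * d) =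
      Poly_Mapping.single (m - ?e + n) (of_nat (Poly_Mapping.lookup m i) * c * d)"
    by (cases "Poly_Mapping.lookup m i = 0") (auto simp: A simp del: One_nat_def)
  moreover have "Poly_Mapping.single (m + n - ?e) (of_nat (Poly_Mapping.lookup n i) * c * d) =
      Poly_Mapping.single (m + (n - ?e)) (of_nat (Poly_Mapping.lookup n i) * c * d)"
    by (cases "Poly_Mapping.lookup n i = 0") (auto simp: B simp del: One_nat_def)
  ultimately show ?thesis
    by (simp add: pd_single mult_single lookup_add distrib_right distrib_left
        single_add mult.assoc mult.left_commute)
qed

lemma pd_mult: "pd i (p * q) = pd i p * q + p * pd i q"
proof (induction p rule: poly6_induct)
  case (single m c)
  show ?case
    by (induction q rule: poly6_induct) (simp_all add: pd_mult_single pd_add algebra_simps)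
qed (simp add: pd_add algebra_simps)

text \<open>
  The extension of the partial derivatives to rational functions by the quotient
  rule; \<open>fd_Fract\<close> below shows that the chosen representation is immaterial.
\<close>

definition fd :: "6 \<Rightarrow> 'k::field_char_0 ratfun6 \<Rightarrow> 'k ratfun6" where
  "fd i f = (let (p, q) = (SOME (p, q). q \<noteq> 0 \<and> f = Fract p q)
     in Fract (pd i p * q - p * pd i q) (q ^ 2))"

lemma fd_Fract:
  assumes "b \<noteq> 0"
  shows "fd i (Fract a b) = Fract (pd i a * b - a * pd i b) (b ^ 2)"
proof -
  obtain c d where cd: "(SOME (p, q). q \<noteq> 0 \<and> Fract a b = Fract p q) = (c, d)" by fastforce
  have "case (SOME (p, q). q \<noteq> 0 \<and> Fract a b = Fract p q) of (p, q) \<Rightarrow> q \<noteq> 0 \<and> Fract a b = Fract p q"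
    by (rule someI[of _ "(a, b)"]) (use assms in auto)
  then have nz: "d \<noteq> 0" and e: "a * d = c * b" using assms by (auto simp: cd eq_fract)
  have e': "pd i a * d + a * pd i d = pd i c * b + c * pd i b"
    using arg_cong[OF e, of "pd i"] by (simp add: pd_mult)
  have "(pd i a * b - a * pd i b) * d ^ 2 - (pd i c * d - c * pd i d) * b ^ 2 =
     b * d * (pd i a * d + a * pd i d - (pd i c * b + c * pd i b))
     - (a * d - c * b) * (d * pd i b + b * pd i d)"
    by (simp add: algebra_simps power2_eq_square)
  also have "\<dots> = 0" using e e' by simp
  finally show ?thesis
    using nz assms by (simp add: fd_def cd eq_fract)
qed

lemma pd_1 [simp]: "pd i 1 = 0"
  using pd_mult[of i 1 1] by simp

lemma fd_to_fract: "fd i (to_fract p) = to_fract (pd i p)"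
  by (simp add: to_fract_def fd_Fract)

lemma fd_const [simp]: "fd i (const c) = 0"
  by (simp add: const_def fd_to_fract pd_single)

lemma fd_X: "fd i (X j) = (if i = j then 1 else 0)"
  by (auto simp: X_def fd_to_fract pd_single lookup_single single_one)

lemma fd_add: "fd i (f + g) = fd i f + fd i g"
proof (cases f; cases g)
  fix a b c d assume "f = Fract a b" "b \<noteq> 0" "g = Fract c d" "d \<noteq> 0"
  then show ?thesis
    by (simp add: fd_Fract pd_mult pd_add eq_fract) (simp add: algebra_simps power2_eq_square)
qed

lemma fd_mult: "fd i (f * g) = fd i f * g + f * fd i g"
proof (cases f; cases g)
  fix a b c d assume "f = Fract a b" "b \<noteq> 0" "g = Fract c d" "d \<noteq> 0"
  then show ?thesis
    by (simp add: fd_Fract pd_mult pd_add eq_fract) (simp add: algebra_simps power2_eq_square)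
qed


section \<open>The Poisson bracket\<close>

text \<open>
  The biderivation of the fraction field with the prescribed values on the
  variables: \<open>{f, g}\<close> is the sum over \<open>i < j\<close> of \<open>{X\<^sub>j, X\<^sub>i}\<close> times
  \<open>(\<partial>\<^sub>j f) (\<partial>\<^sub>i g) - (\<partial>\<^sub>i f) (\<partial>\<^sub>j g)\<close>. On subalgebras we use its restriction.
\<close>

definition pbr :: "'k::field_char_0 ratfun6 \<Rightarrow> 'k ratfun6 \<Rightarrow> 'k ratfun6" where
  "pbr f g = (let D = (\<lambda>j i. fd j f * fd i g - fd i f * fd j g) in
       D 2 1 * (- 3 * X 1 * X 2)
     + D 3 1 * (- X 1 * X 3 - X 2)
     + D 3 2 * (- 3 * X 2 * X 3)
     + D 4 1 * (- 2 * X 3 ^ 2)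
     + D 4 2 * (- 3 * X 2 * X 4 - 4 * X 3 ^ 3)
     + D 4 3 * (- 3 * X 3 * X 4)
     + D 5 1 * (X 1 * X 5 - 2 * X 3)
     + D 5 2 * (- 6 * X 3 ^ 2)
     + D 5 3 * (- X 3 * X 5 - 3 * X 4)
     + D 5 4 * (- 3 * X 4 * X 5)
     + D 6 1 * (3 * X 1 * X 6 - 3 * X 5)
     + D 6 2 * (3 * X 2 * X 6 + 9 * X 4 - 18 * X 3 * X 5)
     + D 6 3 * (- 6 * X 5 ^ 2)
     + D 6 4 * (- 3 * X 4 * X 6 - 4 * X 5 ^ 3)
     + D 6 5 * (- 3 * X 5 * X 6))"

definition poisson_bracket ::
  "('k::field_char_0 ratfun6 \<Rightarrow> 'k ratfun6 \<Rightarrow> 'k ratfun6) \<Rightarrow> bool" where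
  "poisson_bracket B \<longleftrightarrow>
     (\<forall>f g h. B (f + g) h = B f h + B g h) \<and>
     (\<forall>c f g. B (const c * f) g = const c * B f g) \<and>
     (\<forall>f g. B f g = - B g f) \<and>
     (\<forall>f g h. B (f * g) h = B f h * g + f * B g h) \<and>
     (\<forall>f g h. B f (B g h) + B g (B h f) + B h (B f g) = 0)"

lemma pbr_anti: "pbr f g = - pbr g f"
  unfolding pbr_def Let_def by algebra

lemma pbr_add_left: "pbr (f + g) h = pbr f h + pbr g h"
  unfolding pbr_def Let_def fd_add by algebra

lemma pbr_mult_left: "pbr (f * g) h = pbr f h * g + f * pbr g h"
  unfolding pbr_def Let_def fd_mult by algebra

lemma pbr_const_left [simp]: "pbr (const c) h = 0"
  by (simp add: pbr_def)

lemma pbr_add_right: "pbr h (f + g) = pbr h f + pbr h g"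
  using pbr_add_left[of f g h] by (simp add: pbr_anti[of h])

lemma pbr_mult_right: "pbr h (f * g) = pbr h f * g + f * pbr h g"
  using pbr_mult_left[of f g h] by (simp add: pbr_anti[of h])

lemma pbr_const_right [simp]: "pbr h (const c) = 0"
  using pbr_const_left[of c h] by (simp add: pbr_anti[of h])

lemma six_cases: "i = 1 \<or> i = 2 \<or> i = 3 \<or> i = 4 \<or> i = 5 \<or> i = (6::6)"
proof -
  have "(UNIV :: 6 set) = {1, 2, 3, 4, 5, 6}"
    by (rule sym, rule card_subset_eq) simp_all
  then show ?thesis by blast
qed

lemma pbr_X:
  "pbr (X 2) (X 1) = - 3 * X 1 * X 2"
  "pbr (X 3) (X 1) = - X 1 * X 3 - X 2"
  "pbr (X 3) (X 2) = - 3 * X 2 * X 3"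
  "pbr (X 4) (X 1) = - 2 * X 3 ^ 2"
  "pbr (X 4) (X 2) = - 3 * X 2 * X 4 - 4 * X 3 ^ 3"
  "pbr (X 4) (X 3) = - 3 * X 3 * X 4"
  "pbr (X 5) (X 1) = X 1 * X 5 - 2 * X 3"
  "pbr (X 5) (X 2) = - 6 * X 3 ^ 2"
  "pbr (X 5) (X 3) = - X 3 * X 5 - 3 * X 4"
  "pbr (X 5) (X 4) = - 3 * X 4 * X 5"
  "pbr (X 6) (X 1) = 3 * X 1 * X 6 - 3 * X 5"
  "pbr (X 6) (X 2) = 3 * X 2 * X 6 + 9 * X 4 - 18 * X 3 * X 5"
  "pbr (X 6) (X 3) = - 6 * X 5 ^ 2"
  "pbr (X 6) (X 4) = - 3 * X 4 * X 6 - 4 * X 5 ^ 3"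
  "pbr (X 6) (X 5) = - 3 * X 5 * X 6"
  by (simp_all add: pbr_def fd_X)

text \<open>
  A derivation of the fraction field over \<open>'k\<close> is determined by its values on the
  variables. Hence \<open>pbr\<close> satisfies the Jacobi identity and is the only Poisson
  bracket with the prescribed values.
\<close>

lemma const_add: "const (a + b) = const a + const b"
  by (simp add: const_def single_add)

lemma const_1 [simp]: "const 1 = 1"
  by (simp add: const_def)

lemma derivation_eq_0:
  fixes D :: "'k::field_char_0 ratfun6 \<Rightarrow> 'k ratfun6"
  assumes add: "\<And>f g. D (f + g) = D f + D g"
    and mult: "\<And>f g. D (f * g) = D f * g + f * D g"
    and const: "\<And>c. D (const c) = 0"
    and X: "\<And>i. D (X i) = 0"
  shows "D f = 0"
proof -
  let ?e = "\<lambda>i. Poly_Mapping.single i 1 :: 6 \<Rightarrow>\<^sub>0 nat"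
  have mon: "D (to_fract (Poly_Mapping.single m 1)) = 0" for m
  proof (induction "\<Sum>i\<in>UNIV. Poly_Mapping.lookup m i" arbitrary: m)
    case 0
    then have "m = 0" by (intro poly_mapping_eqI) simp
    then show ?case using const[of 1] by simp
  next
    case (Suc n)
    have "\<exists>i. Poly_Mapping.lookup m i \<noteq> 0"
      by (rule ccontr) (use Suc.hyps(2) in simp)
    then obtain i where i: "Poly_Mapping.lookup m i \<noteq> 0" by blast
    define m' where "m' = m - ?e i"
    have m: "m = m' + ?e i"
      using i unfolding m'_def
      by (intro poly_mapping_eqI) (auto simp: lookup_add lookup_minus lookup_single when_def)
    have "(\<Sum>j\<in>UNIV. Poly_Mapping.lookup m j) = (\<Sum>j\<in>UNIV. Poly_Mapping.lookup m' j) + 1"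
      by (simp add: m lookup_add sum.distrib lookup_single when_def)
    then have IH: "D (to_fract (Poly_Mapping.single m' 1)) = 0" using Suc by simp
    have "to_fract (Poly_Mapping.single m 1) =
        to_fract (Poly_Mapping.single m' 1) * (X i :: 'k ratfun6)"
      unfolding X_def by (simp add: m mult_single flip: to_fract_mult)
    then show ?case by (simp add: mult IH X)
  qed
  have pol: "D (to_fract p) = 0" for p
  proof (induction p rule: poly6_induct)
    case (single m c)
    have "to_fract (Poly_Mapping.single m c) = const c * to_fract (Poly_Mapping.single m 1)"
      unfolding const_def by (simp add: mult_single flip: to_fract_mult)
    then show ?case by (simp add: mult mon const)
  qed (simp add: add)
  show ?thesis
  proof (cases f)
    case (Fract a b)
    then have "f * to_fract b = to_fract a" by (simp add: to_fract_def eq_fract)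
    then have "D f * to_fract b = 0" using mult[of f "to_fract b"] pol by simp
    then show ?thesis using Fract by simp
  qed
qed

lemma pbr_self [simp]: "pbr f f = 0"
  by (simp add: pbr_def mult.commute)

lemma pbr_X': "pbr (X j) (X i) = - pbr (X i) (X j)"
  by (rule pbr_anti)

lemma pbr_0_right [simp]: "pbr f 0 = 0"
  using pbr_add_right[of f 0 0] unfolding add_0_right by (simp only: add_cancel_right_right)

lemma pbr_minus_left: "pbr (- f) g = - pbr f g"
  using pbr_add_left[of f "- f" g] pbr_add_left[of 0 0 g]
  by (simp add: add_eq_0_iff)

lemma pbr_minus_right: "pbr g (- f) = - pbr g f"
  using pbr_minus_left[of f g] by (simp add: pbr_anti[of g])

lemma pbr_diff_right: "pbr g (f - h) = pbr g f - pbr g h"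
  using pbr_add_right[of g f "- h"] by (simp add: pbr_minus_right)

lemma const_of_nat: "const (of_nat n) = of_nat n"
proof (induction n)
  case 0
  then show ?case by (simp add: const_def)
next
  case (Suc n)
  then show ?case by (simp add: const_add)
qed

lemma pbr_numeral [simp]: "pbr f (numeral n) = 0"
  using pbr_const_right[of f "of_nat (numeral n)"] unfolding const_of_nat by simp

lemma pbr_power2: "pbr f (g ^ 2) = 2 * g * pbr f g"
  by (simp add: power2_eq_square pbr_mult_right)

lemma pbr_power3: "pbr f (g ^ 3) = 3 * g ^ 2 * pbr f g"
  by (simp add: power3_eq_cube power2_eq_square pbr_mult_right)

definition jacobiator :: "'k::field_char_0 ratfun6 \<Rightarrow> 'k ratfun6 \<Rightarrow> 'k ratfun6 \<Rightarrow> 'k ratfun6" where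
  "jacobiator f g h = pbr f (pbr g h) + pbr g (pbr h f) + pbr h (pbr f g)"

lemma jacobiator_cycle: "jacobiator f g h = jacobiator g h f"
  by (simp add: jacobiator_def)

lemma jacobiator_swap: "jacobiator f g h = - jacobiator f h g"
  unfolding jacobiator_def
  by (simp add: pbr_anti[of g h] pbr_anti[of h f] pbr_anti[of f g] pbr_minus_right)

lemma jacobiator_eq_0I:
  assumes "\<And>i. jacobiator (X i) g h = 0"
  shows "jacobiator f g h = 0"
proof (rule derivation_eq_0[of "\<lambda>f. jacobiator f g h"])
  fix f1 f2 :: "'a ratfun6"
  show "jacobiator (f1 + f2) g h = jacobiator f1 g h + jacobiator f2 g h"
    by (simp add: jacobiator_def pbr_add_left pbr_add_right)
  show "jacobiator (f1 * f2) g h = jacobiator f1 g h * f2 + f1 * jacobiator f2 g h"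
    by (simp add: jacobiator_def pbr_mult_left pbr_mult_right pbr_add_right
        pbr_diff_right pbr_anti[of _ f1] pbr_anti[of _ f2] pbr_minus_right algebra_simps)
next
  fix c :: 'a
  show "jacobiator (const c) g h = 0"
    by (simp add: jacobiator_def)
qed (use assms in simp)

lemma jacobiator_X_ordered:
  "jacobiator (X 3) (X 2) (X 1) = 0"
  "jacobiator (X 4) (X 2) (X 1) = 0"
  "jacobiator (X 4) (X 3) (X 1) = 0"
  "jacobiator (X 4) (X 3) (X 2) = 0"
  "jacobiator (X 5) (X 2) (X 1) = 0"
  "jacobiator (X 5) (X 3) (X 1) = 0"
  "jacobiator (X 5) (X 3) (X 2) = 0"
  "jacobiator (X 5) (X 4) (X 1) = 0"
  "jacobiator (X 5) (X 4) (X 2) = 0"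
  "jacobiator (X 5) (X 4) (X 3) = 0"
  "jacobiator (X 6) (X 2) (X 1) = 0"
  "jacobiator (X 6) (X 3) (X 1) = 0"
  "jacobiator (X 6) (X 3) (X 2) = 0"
  "jacobiator (X 6) (X 4) (X 1) = 0"
  "jacobiator (X 6) (X 4) (X 2) = 0"
  "jacobiator (X 6) (X 4) (X 3) = 0"
  "jacobiator (X 6) (X 5) (X 1) = 0"
  "jacobiator (X 6) (X 5) (X 2) = 0"
  "jacobiator (X 6) (X 5) (X 3) = 0"
  "jacobiator (X 6) (X 5) (X 4) = 0"
  by (simp_all add: jacobiator_def pbr_X pbr_X'[of 1] pbr_X'[of 2 3] pbr_X'[of 2 4]
      pbr_X'[of 2 5] pbr_X'[of 2 6] pbr_X'[of 3 4] pbr_X'[of 3 5] pbr_X'[of 3 6]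
      pbr_X'[of 4 5] pbr_X'[of 4 6] pbr_X'[of 5 6]
      pbr_mult_right pbr_add_right pbr_diff_right pbr_minus_right pbr_power2 pbr_power3
      algebra_simps power2_eq_square power3_eq_cube)

lemma jacobiator_perm:
  assumes "jacobiator f g h = 0"
  shows "jacobiator g h f = 0" "jacobiator h f g = 0" "jacobiator f h g = 0"
    "jacobiator h g f = 0" "jacobiator g f h = 0"
  using assms jacobiator_cycle[of f g h] jacobiator_cycle[of g h f] jacobiator_swap[of f g h]
    jacobiator_swap[of h f g] jacobiator_swap[of g h f]
  by simp_all

lemma jacobiator_same: "jacobiator f g g = 0"
  by (simp add: jacobiator_def pbr_anti[of g f] pbr_minus_right)

lemma jacobiator_X: "jacobiator (X i) (X j) (X k) = 0"
  using six_cases[of i] six_cases[of j] six_cases[of k]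
  by (elim disjE; simp add: jacobiator_X_ordered jacobiator_X_ordered[THEN jacobiator_perm(1)]
      jacobiator_X_ordered[THEN jacobiator_perm(2)] jacobiator_X_ordered[THEN jacobiator_perm(3)]
      jacobiator_X_ordered[THEN jacobiator_perm(4)] jacobiator_X_ordered[THEN jacobiator_perm(5)]
      jacobiator_same jacobiator_same[THEN jacobiator_perm(1)]
      jacobiator_same[THEN jacobiator_perm(2)])

lemma pbr_jacobi: "pbr f (pbr g h) + pbr g (pbr h f) + pbr h (pbr f g) = 0"
proof -
  have 1: "jacobiator f (X j) (X k) = 0" for f :: "'a ratfun6" and j k
    by (rule jacobiator_eq_0I) (rule jacobiator_X)
  have 2: "jacobiator f g (X k) = 0" for f g :: "'a ratfun6" and k
    by (rule jacobiator_eq_0I) (rule jacobiator_perm(2)[OF 1])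
  have "jacobiator f g h = 0"
    by (rule jacobiator_eq_0I) (rule jacobiator_perm(2)[OF 2])
  then show ?thesis by (simp add: jacobiator_def)
qed

theorem poisson_bracket_pbr: "poisson_bracket pbr"
  unfolding poisson_bracket_def
  by (intro conjI allI pbr_add_left pbr_mult_left pbr_anti pbr_jacobi) (simp add: pbr_mult_left)

theorem poisson_bracket_unique:
  assumes B: "poisson_bracket B" and BX: "\<And>i j. B (X i) (X j) = pbr (X i) (X j)"
  shows "B f g = pbr f g"
proof -
  have add: "B (f + g) h = B f h + B g h" and sm: "B (const c * f) g = const c * B f g"
    and anti: "B f g = - B g f" and mult: "B (f * g) h = B f h * g + f * B g h" for c f g h
    using B unfolding poisson_bracket_def by blast+
  have c0: "B (const c) g = 0" for c g
  proof -
    have "B 1 g = 0" using mult[of 1 1 g]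
      unfolding mult_1_left mult_1_right by (simp only: add_cancel_right_right)
    then show ?thesis using sm[of c 1 g] by simp
  qed
  have *: "B f g = pbr f g" if "\<And>i. B (X i) g = pbr (X i) g" for f g
  proof -
    have "B f g - pbr f g = 0"
      by (rule derivation_eq_0[of "\<lambda>f. B f g - pbr f g"])
        (simp_all add: add mult c0 that pbr_add_left pbr_mult_left algebra_simps)
    then show ?thesis by simp
  qed
  have 1: "B f (X j) = pbr f (X j)" for f j
    by (rule *) (rule BX)
  have "B (X i) g = pbr (X i) g" for i
    unfolding anti[of "X i" g] pbr_anti[of "X i" g] 1 ..
  then show ?thesis by (rule *)
qed

definition poisson_centre :: "'k::field_char_0 ratfun6 set \<Rightarrow> 'k ratfun6 set" where
  "poisson_centre A = {a \<in> A. \<forall>b\<in>A. pbr a b = 0}"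


section \<open>The elements T and the algebras\<close>

definition X16 :: "'k::field_char_0 ratfun6" where "X16 = X 1 - 1/2 * X 5 * inverse (X 6)"
definition X26 :: "'k::field_char_0 ratfun6" where
  "X26 = X 2 + 3/2 * X 4 * inverse (X 6) - 3 * X 3 * X 5 * inverse (X 6) + X 5 ^ 3 * inverse (X 6 ^ 2)"
definition X36 :: "'k::field_char_0 ratfun6" where "X36 = X 3 - X 5 ^ 2 * inverse (X 6)"
definition X46 :: "'k::field_char_0 ratfun6" where "X46 = X 4 - 2/3 * X 5 ^ 3 * inverse (X 6)"
definition X56 :: "'k::field_char_0 ratfun6" where "X56 = X 5"

definition X15 :: "'k::field_char_0 ratfun6" where
  "X15 = X16 - X36 * inverse X56 + 3/4 * X46 * inverse (X56 ^ 2)"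
definition X25 :: "'k::field_char_0 ratfun6" where
  "X25 = X26 - 3 * X36 ^ 2 * inverse X56 + 9/2 * X36 * X46 * inverse (X56 ^ 2)
    - 9/4 * X46 ^ 2 * inverse (X56 ^ 3)"
definition X35 :: "'k::field_char_0 ratfun6" where "X35 = X36 - 3/2 * X46 * inverse X56"
definition X45 :: "'k::field_char_0 ratfun6" where "X45 = X46"

definition X14 :: "'k::field_char_0 ratfun6" where "X14 = X15 - 1/3 * X35 ^ 2 * inverse X45"
definition X24 :: "'k::field_char_0 ratfun6" where "X24 = X25 - 2/3 * X35 ^ 3 * inverse X45"
definition X34 :: "'k::field_char_0 ratfun6" where "X34 = X35"

definition X13 :: "'k::field_char_0 ratfun6" where "X13 = X14 - 1/2 * X24 * inverse X34"

definition T1 :: "'k::field_char_0 ratfun6" where "T1 = X13"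
definition T2 :: "'k::field_char_0 ratfun6" where "T2 = X24"
definition T3 :: "'k::field_char_0 ratfun6" where "T3 = X35"
definition T4 :: "'k::field_char_0 ratfun6" where "T4 = X46"
definition T5 :: "'k::field_char_0 ratfun6" where "T5 = X 5"
definition T6 :: "'k::field_char_0 ratfun6" where "T6 = X 6"

definition Omega1 :: "'k::field_char_0 ratfun6" where "Omega1 = T1 * T3 * T5"
definition Omega2 :: "'k::field_char_0 ratfun6" where "Omega2 = T2 * T4 * T6"

text \<open>
  The elements \<open>T\<^sub>i\<close> are algebraically independent and \<open>{T\<^sub>i, T\<^sub>j} = \<mu>\<^sub>i\<^sub>j T\<^sub>i T\<^sub>j\<close> with integers
  \<open>\<mu>\<^sub>i\<^sub>j\<close>, so \<open>alg_Abar\<close> with the restricted bracket is a Poisson affine space;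
  \<open>alg_R1\<close> and \<open>alg_R3\<close> are its localizations at the monomials in all \<open>T\<^sub>i\<close>, respectively
  in \<open>T\<^sub>3, \<dots>, T\<^sub>6\<close>. In contrast, \<open>alg_A\<close> is the polynomial algebra in the \<open>X\<^sub>i\<close>.
\<close>

definition alg_A :: "'k::field_char_0 ratfun6 set" where
  "alg_A = range to_fract"

definition alg_Abar :: "'k::field_char_0 ratfun6 set" where
  "alg_Abar = subalg {T1, T2, T3, T4, T5, T6}"

definition alg_R1 :: "'k::field_char_0 ratfun6 set" where
  "alg_R1 = subalg {T1, inverse T1, T2, inverse T2, T3, inverse T3,
     T4, inverse T4, T5, inverse T5, T6, inverse T6}"

definition alg_R3 :: "'k::field_char_0 ratfun6 set" where
  "alg_R3 = subalg {T1, T2, T3, inverse T3, T4, inverse T4, T5, inverse T5, T6, inverse T6}"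

end

theory Submission
  imports Defs
begin

text \<open>
  The elements \<open>\<Omega>\<^sub>1\<close> and \<open>\<Omega>\<^sub>2\<close> are polynomials in the variables and Poisson-commute with each
  variable, hence with every rational function (\<open>Omega1_central\<close>, \<open>Omega2_central\<close>); so do
  their inverses. This gives one inclusion in all four cases.

  For the other one, solve \<open>\<Omega>\<^sub>1 = T\<^sub>1 T\<^sub>3 T\<^sub>5\<close> and \<open>\<Omega>\<^sub>2 = T\<^sub>2 T\<^sub>4 T\<^sub>6\<close> for \<open>T\<^sub>1\<close> and \<open>T\<^sub>2\<close>. Then
  \<open>R\<^sub>3\<close> consists of Laurent polynomials in \<open>T\<^sub>3, \<dots>, T\<^sub>6\<close> with coefficients in
  \<open>K[\<Omega>\<^sub>1, \<Omega>\<^sub>2]\<close>, and \<open>R\<^sub>1\<close> of those with coefficients in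
  \<open>K[\<Omega>\<^sub>1, \<Omega>\<^sub>1\<^sup>-\<^sup>1, \<Omega>\<^sub>2, \<Omega>\<^sub>2\<^sup>-\<^sup>1]\<close>. A Laurent monomial \<open>m\<close> is a simultaneous eigenvector:
  \<open>{m, T\<^sub>j} = w\<^sub>j m T\<^sub>j\<close> with integers \<open>w\<^sub>j\<close> that depend linearly on the exponents. The matrix
  \<open>(\<mu>\<^sub>i\<^sub>j)\<close> with \<open>3 \<le> i, j \<le> 6\<close> has Pfaffian \<open>3 \<cdot> 3 - 1 \<cdot> 3 + 0 \<cdot> 3 = 6\<close>, so only the trivial
  monomial has all weights zero. In characteristic zero distinct weights are distinct eigenvalues,
  so a Laurent polynomial that commutes with \<open>T\<^sub>3, \<dots>, T\<^sub>6\<close> is equal to the part of weight zero,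
  which is one of the coefficients (\<open>laurent_algebra_centralizer\<close>).

  Both \<open>K[T\<^sub>1, \<dots>, T\<^sub>6]\<close> and \<open>K[X\<^sub>1, \<dots>, X\<^sub>6]\<close> lie in \<open>R\<^sub>3\<close>, the latter because the definition
  of the \<open>T\<^sub>i\<close> can be inverted with denominators in \<open>T\<^sub>3, \<dots>, T\<^sub>6\<close> only
  (\<open>alg_A_subset_alg_R3\<close>). Their central elements commute with \<open>T\<^sub>3, \<dots>, T\<^sub>6\<close>, so that
  the same argument applies to them.
\<close>


section \<open>Rational constants\<close>

text \<open>Characteristic zero is what allows division by numerals and by nonzero weights.\<close>

instance fract :: ("{idom, ring_char_0}") field_char_0
proof
  have of_nat: "of_nat n = (to_fract (of_nat n) :: 'a fract)" for n
    by (induction n) simp_all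
  show "inj (of_nat :: nat \<Rightarrow> 'a fract)"
    by (rule injI) (simp add: of_nat)
qed

lemma const_mult: "const (a * b) = const a * const b"
  by (simp add: const_def mult_single flip: to_fract_mult)

lemma const_0 [simp]: "const 0 = 0"
  by (simp add: const_def)

lemma const_minus: "const (- a) = - const a"
  using const_add[of a "- a"] by (simp add: eq_neg_iff_add_eq_0 add.commute)

lemma const_diff: "const (a - b) = const a - const b"
  using const_add[of a "- b"] by (simp add: const_minus)

lemma const_of_int: "const (of_int n) = of_int n"
  by (cases n) (simp_all add: const_of_nat const_minus flip: of_nat_Suc)

lemma const_inverse_of_int:
  "const (inverse (of_int n)) = (inverse (of_int n) :: 'k::field_char_0 ratfun6)"
proof (cases "n = 0")
  case False
  have "const (inverse (of_int n)) * of_int n = (1 :: 'k ratfun6)"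
    using False by (simp flip: const_of_int const_mult)
  then show ?thesis using False by (simp add: field_simps)
qed simp

lemma const_of_int_divide:
  "const (of_int m / of_int n) = (of_int m / of_int n :: 'k::field_char_0 ratfun6)"
  by (simp add: divide_inverse const_mult const_of_int const_inverse_of_int)


section \<open>Subalgebras\<close>

lemma subalg_scale: "f \<in> subalg S \<Longrightarrow> const c * f \<in> subalg S"
  by (intro subalg.mult subalg.const)

lemma subalg_minus: "f \<in> subalg S \<Longrightarrow> - f \<in> subalg S"
  using subalg_scale[of f S "- 1"] by (simp add: const_minus)

lemma subalg_diff: "f \<in> subalg S \<Longrightarrow> g \<in> subalg S \<Longrightarrow> f - g \<in> subalg S"
  using subalg.add[OF _ subalg_minus, of f S g] by simp

lemma subalg_power: "f \<in> subalg S \<Longrightarrow> f ^ n \<in> subalg S"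
proof (induction n)
  case 0
  show ?case using subalg.const[of 1 S] by simp
qed (simp add: subalg.mult)

lemma subalg_numeral: "numeral n \<in> subalg S"
  using subalg.const[of "of_int (numeral n)" S] unfolding const_of_int by simp

lemma subalg_numeral_divide: "numeral m / numeral n \<in> subalg S"
  using subalg.const[of "of_int (numeral m) / of_int (numeral n)" S]
  unfolding const_of_int_divide by simp

lemma subalg_1_divide: "1 / numeral n \<in> subalg S"
  using subalg.const[of "of_int 1 / of_int (numeral n)" S]
  unfolding const_of_int_divide by simp

lemma subalg_sum_list: "set fs \<subseteq> subalg S \<Longrightarrow> sum_list fs \<in> subalg S"
proof (induction fs)
  case Nil
  show ?case using subalg.const[of 0 S] by simp
qed (simp add: subalg.add)

lemmas subalg_intros = subalg.add subalg.mult subalg_minus subalg_diff subalg_power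
  subalg_numeral_divide subalg_1_divide subalg_numeral

lemma subalg_subset: "S \<subseteq> subalg S' \<Longrightarrow> subalg S \<subseteq> subalg S'"
proof
  fix f assume "S \<subseteq> subalg S'" "f \<in> subalg S"
  from this(2,1) show "f \<in> subalg S'" by induction (auto intro: subalg.intros)
qed

lemma subalg_idem: "subalg (subalg S) \<subseteq> subalg S"
  by (rule subalg_subset) simp

lemma pbr_subalg:
  assumes "f \<in> subalg S" and "\<And>s. s \<in> S \<Longrightarrow> pbr s g = 0"
  shows "pbr f g = 0"
  using assms by induction (simp_all add: pbr_add_left pbr_mult_left)

text \<open>
  With this description all four algebras are generated subalgebras, so inclusions between them can
  be tested on generators.
\<close>

lemma alg_A_eq_subalg: "alg_A = subalg (range (X :: 6 \<Rightarrow> 'k::field_char_0 ratfun6))"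
proof
  have mon: "to_fract (Poly_Mapping.single m 1) \<in> subalg (range (X :: 6 \<Rightarrow> 'k ratfun6))" for m
  proof (induction "\<Sum>i\<in>UNIV. Poly_Mapping.lookup m i" arbitrary: m)
    case 0
    then have "m = 0" by (intro poly_mapping_eqI) simp
    then show ?case using subalg.const[of 1] by simp
  next
    case (Suc n)
    have "\<exists>i. Poly_Mapping.lookup m i \<noteq> 0"
      by (rule ccontr) (use Suc.hyps(2) in simp)
    then obtain i where i: "Poly_Mapping.lookup m i \<noteq> 0" by blast
    define m' where "m' = m - Poly_Mapping.single i 1"
    have m: "m = m' + Poly_Mapping.single i 1"
      using i unfolding m'_def
      by (intro poly_mapping_eqI) (auto simp: lookup_add lookup_minus lookup_single when_def)
    have "(\<Sum>j\<in>UNIV. Poly_Mapping.lookup m j) = (\<Sum>j\<in>UNIV. Poly_Mapping.lookup m' j) + 1"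
      by (simp add: m lookup_add sum.distrib lookup_single when_def)
    then have "n = (\<Sum>j\<in>UNIV. Poly_Mapping.lookup m' j)"
      using Suc.hyps(2) by simp
    then have "to_fract (Poly_Mapping.single m' 1) \<in> subalg (range (X :: 6 \<Rightarrow> 'k ratfun6))"
      by (rule Suc.hyps(1)[of m'])
    moreover have "to_fract (Poly_Mapping.single m 1) = to_fract (Poly_Mapping.single m' 1) * (X i :: 'k ratfun6)"
      unfolding X_def by (simp add: m mult_single flip: to_fract_mult)
    ultimately show ?case by (simp add: subalg.mult subalg.gen)
  qed
  have "to_fract p \<in> subalg (range (X :: 6 \<Rightarrow> 'k ratfun6))" for p
  proof (induction p rule: poly6_induct)
    case (single m c)
    have "to_fract (Poly_Mapping.single m c) = const c * to_fract (Poly_Mapping.single m 1)"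
      unfolding const_def by (simp add: mult_single flip: to_fract_mult)
    then show ?case by (simp add: subalg_scale mon)
  qed (simp add: subalg.add)
  then show "alg_A \<subseteq> subalg (range (X :: 6 \<Rightarrow> 'k ratfun6))" by (auto simp: alg_A_def)
  show "subalg (range (X :: 6 \<Rightarrow> 'k ratfun6)) \<subseteq> alg_A"
  proof
    fix f :: "'k ratfun6" assume "f \<in> subalg (range X)"
    then show "f \<in> alg_A"
      by induction (auto simp: alg_A_def const_def X_def simp flip: to_fract_add to_fract_mult)
  qed
qed


section \<open>Derivatives and brackets\<close>

lemma fd_0 [simp]: "fd i 0 = 0"
  using fd_const[of i 0] by simp

lemma fd_minus: "fd i (- f) = - fd i f"
  using fd_add[of i f "- f"] by (simp add: eq_neg_iff_add_eq_0 add.commute)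

lemma fd_diff: "fd i (f - g) = fd i f - fd i g"
  using fd_add[of i f "- g"] by (simp add: fd_minus)

lemma fd_numeral [simp]: "fd i (numeral n) = 0"
  using fd_const[of i "of_int (numeral n)"] unfolding const_of_int by simp

text \<open>
  Differentiating by a variable that occurs linearly strips an expression down to a coefficient that
  is visibly nonzero.
\<close>

lemma nonzeroI: "fd i f \<noteq> 0 \<Longrightarrow> f \<noteq> 0"
  by auto

lemma X_nonzero [simp]: "X i \<noteq> 0"
  by (rule nonzeroI[of i]) (simp add: fd_X)

lemma pbr_0_left [simp]: "pbr 0 f = 0"
  by (simp add: pbr_anti[of 0])

lemma pbr_diff_left: "pbr (f - g) h = pbr f h - pbr g h"
  using pbr_add_left[of f "- g" h] by (simp add: pbr_minus_left)

lemma pbr_numeral_left [simp]: "pbr (numeral n) f = 0"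
  by (subst pbr_anti) simp

lemma pbr_inverse_left:
  assumes "f \<noteq> 0"
  shows "pbr (inverse f) g = - pbr f g * inverse (f ^ 2)"
proof -
  have "pbr (inverse f * f) g = 0"
    using pbr_const_left[of 1] assms by simp
  then have "pbr (inverse f) g * f = - inverse f * pbr f g"
    by (simp add: pbr_mult_left eq_neg_iff_add_eq_0)
  then show ?thesis using assms by (simp add: field_simps power2_eq_square)
qed

lemma pbr_divide_numeral_left: "pbr (f / numeral n) g = pbr f g / numeral n"
proof -
  have "pbr (inverse (numeral n)) g = 0"
    by (subst pbr_inverse_left) simp_all
  then show ?thesis by (simp only: divide_inverse pbr_mult_left) simp
qed

lemma pbr_divide_numeral_right: "pbr g (f / numeral n) = pbr g f / numeral n"
  by (simp add: pbr_anti[of g] pbr_divide_numeral_left)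

lemma pbr_power_left: "pbr (f ^ 2) g = 2 * f * pbr f g" "pbr (f ^ 3) g = 3 * f ^ 2 * pbr f g"
  using pbr_power2[of g f] pbr_power3[of g f] by (simp_all add: pbr_anti[of _ g])

text \<open>Commuting with the six variables is enough: a derivation that kills them is zero.\<close>

lemma pbr_eq_0I:
  assumes "\<And>i. pbr f (X i) = 0"
  shows "pbr f g = 0"
  by (rule derivation_eq_0) (simp_all add: pbr_add_right pbr_mult_right assms)

lemmas pbr_X_reversed = pbr_X'[of 1 2] pbr_X'[of 1 3] pbr_X'[of 1 4] pbr_X'[of 1 5]
  pbr_X'[of 1 6] pbr_X'[of 2 3] pbr_X'[of 2 4]
  pbr_X'[of 2 5] pbr_X'[of 2 6] pbr_X'[of 3 4] pbr_X'[of 3 5] pbr_X'[of 3 6]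
  pbr_X'[of 4 5] pbr_X'[of 4 6] pbr_X'[of 5 6]


section \<open>Skew-commuting elements\<close>

text \<open>
  The eigenvalue of \<open>f\<close> under the derivation \<open>{-, t} / t\<close>. The predicate takes the weight as an
  argument since \<open>f = 0\<close> has every weight.
\<close>

definition weight :: "'k::field_char_0 ratfun6 \<Rightarrow> int \<Rightarrow> 'k ratfun6 \<Rightarrow> bool" where
  "weight t w f \<longleftrightarrow> pbr f t = of_int w * f * t"

lemma weight_0_iff: "weight t 0 f \<longleftrightarrow> pbr f t = 0"
  by (simp add: weight_def)

lemma weight_self: "weight t 0 t"
  by (simp add: weight_def)

lemma weight_swap: "weight t w f \<Longrightarrow> weight f (- w) t"
  by (simp add: weight_def pbr_anti[of t] algebra_simps)

lemma weight_mult: "weight t w f \<Longrightarrow> weight t w' g \<Longrightarrow> weight t (w + w') (f * g)"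
  by (simp add: weight_def pbr_mult_left algebra_simps)

lemma weight_1: "weight t 0 1"
  using pbr_const_left[of 1] by (simp add: weight_def)

lemma weight_inverse: "f \<noteq> 0 \<Longrightarrow> weight t w f \<Longrightarrow> weight t (- w) (inverse f)"
  by (simp add: weight_def pbr_inverse_left power2_eq_square)

lemma weight_power: "weight t w f \<Longrightarrow> weight t (int n * w) (f ^ n)"
  using weight_1 by (induction n) (auto simp: ring_distribs intro: weight_mult)

lemma weight_power_int:
  assumes "f \<noteq> 0" "weight t w f"
  shows "weight t (n * w) (f powi n)"
proof (cases n rule: int_cases2)
  case (nonneg m)
  then show ?thesis using weight_power[OF assms(2), of m] by simp
next
  case (nonpos m)
  then show ?thesis
    using weight_inverse[OF _ weight_power[OF assms(2), of m]] assms(1) by (simp add: power_int_minus)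
qed


section \<open>The elements \<open>T\<^sub>3, \<dots>, T\<^sub>6\<close> and the central elements\<close>

lemma T3_eq: "T3 = X 3 - 3/2 * X 4 * inverse (X 5)"
  by (simp add: T3_def X35_def X36_def X46_def X56_def field_simps power2_eq_square power3_eq_cube)

lemma T4_eq: "T4 = X 4 - 2/3 * X 5 ^ 3 * inverse (X 6)"
  by (simp add: T4_def X46_def)

lemma T3_nonzero [simp]: "T3 \<noteq> 0"
proof -
  have "2 * X 3 * X 5 - 3 * X 4 \<noteq> (0 :: 'a ratfun6)"
    by (rule nonzeroI[of 3]) (simp add: fd_diff fd_mult fd_X power2_eq_square power3_eq_cube)
  then show ?thesis by (simp add: T3_eq field_simps)
qed

lemma T4_nonzero [simp]: "T4 \<noteq> 0"
proof -
  have "3 * X 4 * X 6 - 2 * X 5 ^ 3 \<noteq> (0 :: 'a ratfun6)"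
    by (rule nonzeroI[of 4]) (simp add: fd_diff fd_mult fd_X power2_eq_square power3_eq_cube)
  then show ?thesis by (simp add: T4_eq field_simps)
qed

lemma T5_nonzero [simp]: "T5 \<noteq> 0" and T6_nonzero [simp]: "T6 \<noteq> 0"
  by (simp_all add: T5_def T6_def)

text \<open>
  The tower of denominators is removed one level at a time: the terms with \<open>T\<^sub>3\<close> and \<open>T\<^sub>4\<close> in the
  denominator cancel first, then those with \<open>X\<^sub>5\<close>, then those with \<open>X\<^sub>6\<close>. At each of the last
  two levels only one inverse is left, which is treated as a further indeterminate.
\<close>

lemma Omega1_eq_X6: "Omega1 = X16 * X36 * X 5 - 3/2 * X16 * X46 - 1/2 * X26 * X 5 + 1/2 * X36 ^ 2"
proof -
  have T: "T1 * T3 = (X15 * T3 - 1/2 * X25 :: 'a ratfun6)"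
    using T3_nonzero T4_nonzero
    by (simp add: T1_def X13_def X34_def X14_def X24_def X45_def T3_def[symmetric]
        T4_def[symmetric] field_simps power2_eq_square power3_eq_cube)
  define u where "u = inverse (X 5 :: 'a ratfun6)"
  then have "u * X 5 = 1" by simp
  then show ?thesis
    unfolding Omega1_def T unfolding T5_def T3_def X15_def X25_def X35_def X56_def
      power_inverse[symmetric] u_def[symmetric] by algebra
qed

lemma Omega2_eq_X6: "Omega2 = (X26 * X46 - 2/3 * X36 ^ 3) * X 6"
proof -
  have T: "T2 * T4 = (X25 * T4 - 2/3 * T3 ^ 3 :: 'a ratfun6)"
    using T4_nonzero
    by (simp add: T2_def X24_def X45_def T3_def[symmetric] T4_def[symmetric] field_simps)
  define u where "u = inverse (X 5 :: 'a ratfun6)"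
  show ?thesis
    unfolding Omega2_def T unfolding T6_def T3_def T4_def X25_def X35_def X56_def
      power_inverse[symmetric] u_def[symmetric] by algebra
qed

lemma Omega1_eq:
  "Omega1 = X 1 * X 3 * X 5 - 3/2 * X 1 * X 4 - 1/2 * X 2 * X 5 + 1/2 * X 3 ^ 2"
proof -
  define v where "v = inverse (X 6 :: 'a ratfun6)"
  show ?thesis
    unfolding Omega1_eq_X6 X16_def X26_def X36_def X46_def
      power_inverse[symmetric] v_def[symmetric] by algebra
qed

lemma Omega2_eq:
  "Omega2 = X 2 * X 4 * X 6 - 2/3 * X 3 ^ 3 * X 6 - 2/3 * X 2 * X 5 ^ 3 + 2 * X 3 ^ 2 * X 5 ^ 2
    - 3 * X 3 * X 4 * X 5 + 3/2 * X 4 ^ 2"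
proof -
  define v where "v = inverse (X 6 :: 'a ratfun6)"
  have "X26 * X46 - 2/3 * X36 ^ 3 = X 2 * X 4 - 2/3 * X 3 ^ 3
      + v * (- 2/3 * X 2 * X 5 ^ 3 + 2 * X 3 ^ 2 * X 5 ^ 2 - 3 * X 3 * X 4 * X 5 + 3/2 * X 4 ^ 2)"
    unfolding X26_def X36_def X46_def power_inverse[symmetric] v_def[symmetric] by algebra
  then have "Omega2 = (X 2 * X 4 - 2/3 * X 3 ^ 3) * X 6 + (v * X 6) *
      (- 2/3 * X 2 * X 5 ^ 3 + 2 * X 3 ^ 2 * X 5 ^ 2 - 3 * X 3 * X 4 * X 5 + 3/2 * X 4 ^ 2)"
    by (simp only: Omega2_eq_X6 distrib_right mult.assoc mult.commute[of "X 6"])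
  also have "v * X 6 = 1" by (simp add: v_def)
  finally show ?thesis by (simp add: algebra_simps)
qed

lemma Omega1_central: "pbr Omega1 f = (0 :: 'k::field_char_0 ratfun6)"
proof (rule pbr_eq_0I)
  fix i
  \<comment> \<open>Integer coefficients keep the identity within commutative ring arithmetic.\<close>
  have "2 * Omega1 = (2 * X 1 * X 3 * X 5 - 3 * X 1 * X 4 - X 2 * X 5 + X 3 ^ 2 :: 'k ratfun6)" (is "_ = ?P")
    by (simp add: Omega1_eq algebra_simps)
  moreover have "pbr ?P (X i) = 0"
    using six_cases[of i]
    by (elim disjE; simp add: pbr_diff_left pbr_add_left pbr_mult_left pbr_power_left pbr_X
        pbr_X_reversed; simp add: algebra_simps power2_eq_square power3_eq_cube)
  ultimately have "pbr (2 * Omega1) (X i) = (0 :: 'k ratfun6)" by simp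
  then show "pbr Omega1 (X i) = (0 :: 'k ratfun6)" by (simp add: pbr_mult_left)
qed

lemma Omega2_central: "pbr Omega2 f = (0 :: 'k::field_char_0 ratfun6)"
proof (rule pbr_eq_0I)
  fix i
  \<comment> \<open>The factor 6 clears the denominators 2 and 3.\<close>
  have "6 * Omega2 = (6 * X 2 * X 4 * X 6 - 4 * X 3 ^ 3 * X 6 - 4 * X 2 * X 5 ^ 3 + 12 * X 3 ^ 2 * X 5 ^ 2
    - 18 * X 3 * X 4 * X 5 + 9 * X 4 ^ 2 :: 'k ratfun6)" (is "_ = ?P")
    by (simp add: Omega2_eq algebra_simps)
  moreover have "pbr ?P (X i) = 0"
    using six_cases[of i]
    by (elim disjE; simp add: pbr_diff_left pbr_add_left pbr_mult_left pbr_power_left pbr_X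
        pbr_X_reversed; simp add: algebra_simps power2_eq_square power3_eq_cube)
  ultimately have "pbr (6 * Omega2) (X i) = (0 :: 'k ratfun6)" by simp
  then show "pbr Omega2 (X i) = (0 :: 'k ratfun6)" by (simp add: pbr_mult_left)
qed

text \<open>
  \<open>P3 = T\<^sub>3 X\<^sub>5\<close> and \<open>P4 = T\<^sub>4 X\<^sub>6\<close> are polynomials, so their brackets with one another and with
  \<open>X\<^sub>5\<close>, \<open>X\<^sub>6\<close> are polynomial identities. The brackets of \<open>T\<^sub>3, \<dots>, T\<^sub>6\<close> follow, since
  weights are additive on products.
\<close>

lemma X_polynomial_weights:
  fixes P3 P4 :: "'k::field_char_0 ratfun6"
  defines "P3 \<equiv> X 3 * X 5 - 3/2 * X 4" and "P4 \<equiv> X 4 * X 6 - 2/3 * X 5 ^ 3"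
  shows "weight P4 3 P3" "weight (X 5) 1 P3" "weight (X 6) 3 P3"
    "weight (X 5) 0 P4" "weight (X 6) 3 P4" "weight (X 6) 3 (X 5 :: 'k ratfun6)"
  by (simp_all add: weight_def P3_def P4_def pbr_diff_left pbr_mult_left pbr_divide_numeral_left
      pbr_power_left pbr_diff_right pbr_mult_right pbr_X pbr_X_reversed pbr_power3
      pbr_divide_numeral_right) (simp_all add: field_simps power2_eq_square power3_eq_cube)

lemma T_weights:
  "weight T4 3 (T3 :: 'k::field_char_0 ratfun6)" "weight T5 1 (T3 :: 'k ratfun6)"
  "weight T6 0 (T3 :: 'k ratfun6)" "weight T5 3 (T4 :: 'k ratfun6)"
  "weight T6 3 (T4 :: 'k ratfun6)" "weight T6 3 (T5 :: 'k ratfun6)"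
proof -
  let ?P3 = "X 3 * X 5 - 3/2 * X 4 :: 'k ratfun6" and ?P4 = "X 4 * X 6 - 2/3 * X 5 ^ 3 :: 'k ratfun6"
  note P = X_polynomial_weights[where ?'k = 'k]
  have T3: "T3 = ?P3 * inverse (X 5)" and T4: "T4 = ?P4 * inverse (X 6)"
    by (simp_all add: T3_eq T4_eq field_simps)
  show "weight T5 1 (T3 :: 'k ratfun6)"
    using weight_mult[OF P(2) weight_inverse[OF X_nonzero weight_self]]
    unfolding T3 T5_def by simp
  show "weight T5 3 (T4 :: 'k ratfun6)"
    using weight_mult[OF P(4) weight_inverse[OF X_nonzero weight_swap[OF P(6)]]]
    unfolding T4 T5_def by simp
  show 63: "weight T6 0 (T3 :: 'k ratfun6)"
    using weight_mult[OF P(3) weight_inverse[OF X_nonzero P(6)]]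
    unfolding T3 T6_def by simp
  show "weight T6 3 (T4 :: 'k ratfun6)"
    using weight_mult[OF P(5) weight_inverse[OF X_nonzero weight_self]]
    unfolding T4 T6_def by simp
  show "weight T6 3 (T5 :: 'k ratfun6)"
    using P(6) by (simp add: T5_def T6_def)
  have "weight ?P4 3 T3"
    using weight_mult[OF P(1) weight_inverse[OF X_nonzero weight_swap[OF P(4)]]]
    unfolding T3 by simp
  from weight_mult[OF weight_swap[OF this] weight_inverse[OF T6_nonzero weight_swap[OF 63]]]
  have "weight T3 (- 3) (T4 :: 'k ratfun6)"
    unfolding T4 T6_def by simp
  from weight_swap[OF this] show "weight T4 3 (T3 :: 'k ratfun6)" by simp
qed


section \<open>Laurent polynomials over Poisson-commuting coefficients\<close>

definition laurent_monomial :: "int \<Rightarrow> int \<Rightarrow> int \<Rightarrow> int \<Rightarrow> 'k::field_char_0 ratfun6" where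
  "laurent_monomial a b c d = T3 powi a * T4 powi b * T5 powi c * T6 powi d"

text \<open>
  The coefficient ranges over a whole subalgebra, so that the terms are closed under products and
  under scaling by constants.
\<close>

definition laurent_terms :: "'k::field_char_0 ratfun6 set \<Rightarrow> 'k ratfun6 set" where
  "laurent_terms S = {s * laurent_monomial a b c d | s a b c d. s \<in> subalg S}"

lemma laurent_monomial_add:
  "laurent_monomial a b c d * laurent_monomial a' b' c' d' =
     laurent_monomial (a + a') (b + b') (c + c') (d + d')"
  by (simp add: laurent_monomial_def power_int_add mult_ac)

lemma laurent_termsI: "s \<in> subalg S \<Longrightarrow> s * laurent_monomial a b c d \<in> laurent_terms S"
  unfolding laurent_terms_def by blast

lemma laurent_terms_mult:
  assumes "f \<in> laurent_terms S" "g \<in> laurent_terms S"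
  shows "f * g \<in> laurent_terms S"
proof -
  obtain s a b c d s' a' b' c' d' where s: "s \<in> subalg S" "s' \<in> subalg S"
    and f: "f = s * laurent_monomial a b c d" and g: "g = s' * laurent_monomial a' b' c' d'"
    using assms unfolding laurent_terms_def by blast
  have "f * g = (s * s') * (laurent_monomial a b c d * laurent_monomial a' b' c' d')"
    unfolding f g by (simp only: mult_ac)
  then show ?thesis
    unfolding laurent_monomial_add using s by (auto intro: laurent_termsI subalg.mult)
qed

lemma subalg_subset_laurent_terms: "subalg S \<subseteq> laurent_terms S"
  using laurent_termsI[of _ S 0 0 0 0] by (auto simp: laurent_monomial_def)

lemma laurent_terms_T:
  "T3 \<in> laurent_terms S" "inverse T3 \<in> laurent_terms S"
  "T4 \<in> laurent_terms S" "inverse T4 \<in> laurent_terms S"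
  "T5 \<in> laurent_terms S" "inverse T5 \<in> laurent_terms S"
  "T6 \<in> laurent_terms S" "inverse T6 \<in> laurent_terms S"
  using laurent_termsI[OF subalg.const[of 1 S], of 1 0 0 0]
    laurent_termsI[OF subalg.const[of 1 S], of "- 1" 0 0 0]
    laurent_termsI[OF subalg.const[of 1 S], of 0 1 0 0]
    laurent_termsI[OF subalg.const[of 1 S], of 0 "- 1" 0 0]
    laurent_termsI[OF subalg.const[of 1 S], of 0 0 1 0]
    laurent_termsI[OF subalg.const[of 1 S], of 0 0 "- 1" 0]
    laurent_termsI[OF subalg.const[of 1 S], of 0 0 0 1]
    laurent_termsI[OF subalg.const[of 1 S], of 0 0 0 "- 1"]
  by (simp_all add: laurent_monomial_def power_int_minus)

definition laurent_algebra :: "'k::field_char_0 ratfun6 set \<Rightarrow> 'k ratfun6 set" where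
  "laurent_algebra S = subalg (S \<union> {T3, inverse T3, T4, inverse T4, T5, inverse T5, T6, inverse T6})"

lemma laurent_algebra_sum:
  assumes "f \<in> laurent_algebra S"
  shows "\<exists>ts. set ts \<subseteq> laurent_terms S \<and> f = sum_list ts"
  using assms unfolding laurent_algebra_def
proof induction
  case (const c)
  then show ?case
    using subalg_subset_laurent_terms subalg.const[of c S] by (intro exI[of _ "[const c]"]) auto
next
  case (gen f)
  then have "f \<in> laurent_terms S"
    using laurent_terms_T subalg_subset_laurent_terms subalg.gen[of f S] by blast
  then show ?case by (intro exI[of _ "[f]"]) simp
next
  case (add f g)
  then obtain fs gs where "set fs \<subseteq> laurent_terms S" "f = sum_list fs"
    "set gs \<subseteq> laurent_terms S" "g = sum_list gs" by blast
  then show ?case by (intro exI[of _ "fs @ gs"]) simp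
next
  case (mult f g)
  then obtain fs gs where *: "set fs \<subseteq> laurent_terms S" "f = sum_list fs"
    "set gs \<subseteq> laurent_terms S" "g = sum_list gs" by blast
  have "sum_list fs * sum_list gs = sum_list (concat (map (\<lambda>x. map ((*) x) gs) fs))"
    by (induction fs) (simp_all add: distrib_right sum_list_const_mult)
  moreover have "set (concat (map (\<lambda>x. map ((*) x) gs) fs)) \<subseteq> laurent_terms S"
    using * laurent_terms_mult by fastforce
  ultimately show ?case using * by blast
qed

text \<open>The coefficients are the columns of the matrix \<open>(\<mu>\<^sub>i\<^sub>j)\<close> restricted to \<open>3 \<le> i, j \<le> 6\<close>.\<close>

lemma laurent_monomial_weights:
  "weight T3 (- 3 * b - c) (laurent_monomial a b c d :: 'k::field_char_0 ratfun6)"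
  "weight T4 (3 * a - 3 * c - 3 * d) (laurent_monomial a b c d :: 'k ratfun6)"
  "weight T5 (a + 3 * b - 3 * d) (laurent_monomial a b c d :: 'k ratfun6)"
  "weight T6 (3 * b + 3 * c) (laurent_monomial a b c d :: 'k ratfun6)"
proof -
  have prod: "weight t w (laurent_monomial a b c d)"
    if "weight t w3 T3" "weight t w4 T4" "weight t w5 T5" "weight t w6 T6"
      "w = a * w3 + b * w4 + c * w5 + d * w6"
    for t :: "'k ratfun6" and w w3 w4 w5 w6
    unfolding that(5) laurent_monomial_def by (intro weight_mult weight_power_int that) simp_all
  note T = T_weights[where ?'k = 'k] and T' = T_weights[where ?'k = 'k, THEN weight_swap]
  show "weight T3 (- 3 * b - c) (laurent_monomial a b c d :: 'k ratfun6)"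
    by (rule prod[OF weight_self T'(1) T'(2) T'(3)]) simp
  show "weight T4 (3 * a - 3 * c - 3 * d) (laurent_monomial a b c d :: 'k ratfun6)"
    by (rule prod[OF T(1) weight_self T'(4) T'(5)]) simp
  show "weight T5 (a + 3 * b - 3 * d) (laurent_monomial a b c d :: 'k ratfun6)"
    by (rule prod[OF T(2) T(4) weight_self T'(6)]) simp
  show "weight T6 (3 * b + 3 * c) (laurent_monomial a b c d :: 'k ratfun6)"
    by (rule prod[OF T(3) T(5) T(6) weight_self]) simp
qed

context
  fixes S :: "'k::field_char_0 ratfun6 set"
  assumes commute: "\<And>s t. s \<in> S \<Longrightarrow> t \<in> {T3, T4, T5, T6} \<Longrightarrow> pbr s t = 0"
begin

lemma laurent_term_weightI:
  assumes "s \<in> subalg S" "t \<in> {T3, T4, T5, T6}" "weight t w (laurent_monomial a b c d)"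
  shows "weight t w (s * laurent_monomial a b c d)"
proof -
  have "weight t 0 s"
    unfolding weight_0_iff using assms commute by (blast intro: pbr_subalg)
  from weight_mult[OF this assms(3)] show ?thesis by simp
qed

lemma laurent_term_weight:
  assumes "f \<in> laurent_terms S" "t \<in> {T3, T4, T5, T6}"
  shows "\<exists>w. weight t w f"
proof -
  obtain s a b c d where s: "s \<in> subalg S" and f: "f = s * laurent_monomial a b c d"
    using assms(1) unfolding laurent_terms_def by blast
  have "\<exists>w. weight t w (laurent_monomial a b c d)"
    using assms(2) laurent_monomial_weights by fast
  then show ?thesis
    unfolding f using laurent_term_weightI[OF s assms(2)] by blast
qed

text \<open>
  The matrix of weights is nonsingular: if all four weights vanish, so do all exponents, and the
  term is a bare coefficient.
\<close>

lemma laurent_term_nonzero_weight: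
  assumes "f \<in> laurent_terms S" "f \<notin> subalg S"
  obtains t w where "t \<in> {T3, T4, T5, T6}" "w \<noteq> 0" "weight t w f"
proof -
  obtain s a b c d where s: "s \<in> subalg S" and f: "f = s * laurent_monomial a b c d"
    using assms unfolding laurent_terms_def by blast
  have "\<not> (a = 0 \<and> b = 0 \<and> c = 0 \<and> d = 0)"
    using assms(2) s f by (auto simp: laurent_monomial_def)
  then have "- 3 * b - c \<noteq> 0 \<or> 3 * a - 3 * c - 3 * d \<noteq> 0 \<or> a + 3 * b - 3 * d \<noteq> 0 \<or> 3 * b + 3 * c \<noteq> 0"
    by presburger
  moreover have "weight T3 (- 3 * b - c) f" "weight T4 (3 * a - 3 * c - 3 * d) f"
    "weight T5 (a + 3 * b - 3 * d) f" "weight T6 (3 * b + 3 * c) f"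
    unfolding f by (intro laurent_term_weightI[OF s] laurent_monomial_weights; simp)+
  ultimately show thesis
    using that[of T3] that[of T4] that[of T5] that[of T6] by blast
qed

text \<open>
  Let \<open>x\<close> be a term of weight \<open>l \<noteq> 0\<close> under \<open>t\<close>. As the sum has weight zero, it is unchanged by
  the operator \<open>1 - {-, t} / (l t)\<close>, which kills \<open>x\<close> and multiplies each remaining term by a
  constant. So the same element is a sum of fewer terms. Repeating this ends with terms that
  are coefficients.
\<close>

lemma laurent_sum_in_subalg:
  assumes "set ts \<subseteq> laurent_terms S" and "\<And>t. t \<in> {T3, T4, T5, T6} \<Longrightarrow> pbr (sum_list ts) t = 0"
  shows "sum_list ts \<in> subalg S"
  using assms
proof (induction ts rule: length_induct)
  case (1 ts)
  show ?case
  proof (cases "set ts \<subseteq> subalg S")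
    case True
    then show ?thesis by (rule subalg_sum_list)
  next
    case False
    then obtain x where x: "x \<in> set ts" "x \<notin> subalg S" by blast
    with 1(2) obtain t l where t: "t \<in> {T3, T4, T5, T6}" and l: "l \<noteq> 0" "weight t l x"
      using laurent_term_nonzero_weight by blast
    define us where "us = remove1 x ts"
    have sum: "sum_list ts = x + sum_list us"
      using sum_list_map_remove1[OF x(1), of "\<lambda>y. y"] by (simp add: us_def)
    have us: "set us \<subseteq> laurent_terms S"
      using 1(2) set_remove1_subset[of x ts] by (auto simp: us_def)
    then have "\<forall>y\<in>set us. \<exists>w. weight t w y"
      using laurent_term_weight[OF _ t] by blast
    then obtain w where w: "\<And>y. y \<in> set us \<Longrightarrow> weight t (w y) y" by metis
    have bracket: "pbr (sum_list zs) t = (\<Sum>y\<leftarrow>zs. of_int (w y) * y) * t" if "set zs \<subseteq> set us" for zs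
      using that w by (induction zs) (auto simp: pbr_add_left weight_def algebra_simps)
    have "t \<noteq> 0" using t by auto
    moreover have "(of_int l * x + (\<Sum>y\<leftarrow>us. of_int (w y) * y)) * t = 0"
      using 1(3)[OF t] bracket[of us] l(2) by (simp add: sum pbr_add_left weight_def algebra_simps)
    ultimately have rel: "of_int l * x = - (\<Sum>y\<leftarrow>us. of_int (w y) * y)"
      by (simp add: eq_neg_iff_add_eq_0)
    define vs where "vs = map (\<lambda>y. const (1 - of_int (w y) / of_int l) * y) us"
    have "of_int l * (const (1 - of_int (w y) / of_int l) * y) = of_int l * y - of_int (w y) * y"
      for y :: "'k ratfun6"
      using l(1) by (simp only: const_diff const_of_int_divide const_1) (simp add: field_simps)
    then have "of_int l * sum_list vs = (\<Sum>y\<leftarrow>us. of_int l * y - of_int (w y) * y)"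
      by (simp add: vs_def flip: sum_list_const_mult)
    also have "\<dots> = of_int l * sum_list ts"
      by (simp add: sum sum_list_subtractf sum_list_const_mult distrib_left rel)
    finally have ts: "sum_list ts = sum_list vs" using l(1) by simp
    have "length vs < length ts"
      using x(1) length_pos_if_in_set[OF x(1)] by (simp add: vs_def us_def length_remove1)
    moreover have "set vs \<subseteq> laurent_terms S"
      using us laurent_terms_mult subalg_subset_laurent_terms subalg.const unfolding vs_def by fastforce
    ultimately show ?thesis using 1(1,3) ts by metis
  qed
qed

lemma laurent_algebra_centralizer:
  assumes "f \<in> laurent_algebra S" and "\<And>t. t \<in> {T3, T4, T5, T6} \<Longrightarrow> pbr f t = 0"
  shows "f \<in> subalg S"
  using laurent_algebra_sum[OF assms(1)] assms(2) laurent_sum_in_subalg by blast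

end

text \<open>
  The common form of the four cases. The last assumption is immediate from the
  definition of the centre when \<open>T\<^sub>3, \<dots>, T\<^sub>6\<close> belong to \<open>A\<close>, but not for the polynomial algebra
  in the \<open>X\<^sub>i\<close>, which does not contain \<open>T\<^sub>3\<close> and \<open>T\<^sub>4\<close>.
\<close>

lemma poisson_centre_eq_subalg:
  fixes A S :: "'k::field_char_0 ratfun6 set"
  assumes "A \<subseteq> laurent_algebra S" "S \<subseteq> A" and A: "subalg A \<subseteq> A"
    and central: "\<And>s f. s \<in> S \<Longrightarrow> pbr s f = 0"
    and T: "\<And>f t. f \<in> poisson_centre A \<Longrightarrow> t \<in> {T3, T4, T5, T6} \<Longrightarrow> pbr f t = 0"
  shows "poisson_centre A = subalg S"
proof
  show "poisson_centre A \<subseteq> subalg S"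
  proof
    fix f assume f: "f \<in> poisson_centre A"
    then have "f \<in> laurent_algebra S"
      using assms(1) by (auto simp: poisson_centre_def)
    then show "f \<in> subalg S"
      by (rule laurent_algebra_centralizer[rotated]) (use central T[OF f] in auto)
  qed
  have "subalg S \<subseteq> A"
    using subalg_subset[of S A] subalg.gen assms(2) A by blast
  then show "subalg S \<subseteq> poisson_centre A"
    using pbr_subalg[OF _ central] by (auto simp: poisson_centre_def)
qed


section \<open>The four algebras\<close>

lemma T1_eq: "T1 = Omega1 * inverse T3 * inverse T5" and T2_eq: "T2 = Omega2 * inverse T4 * inverse T6"
  by (simp_all add: Omega1_def Omega2_def field_simps)

lemma alg_R1_subset: "alg_R1 \<subseteq> laurent_algebra {Omega1, inverse Omega1, Omega2, inverse Omega2}"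
  unfolding alg_R1_def laurent_algebra_def
proof (rule subalg_subset)
  let ?G = "{Omega1, inverse Omega1, Omega2, inverse Omega2} \<union>
    {T3, inverse T3, T4, inverse T4, T5, inverse T5, T6, inverse T6} :: 'a ratfun6 set"
  have "T1 \<in> subalg ?G" "T2 \<in> subalg ?G"
    unfolding T1_eq T2_eq by (intro subalg.mult subalg.gen; simp)+
  moreover have inverse_T: "inverse T1 = inverse Omega1 * T3 * T5"
    "inverse T2 = inverse Omega2 * T4 * (T6 :: 'a ratfun6)"
    by (simp_all add: T1_eq T2_eq)
  have "inverse T1 \<in> subalg ?G" "inverse T2 \<in> subalg ?G"
    unfolding inverse_T by (intro subalg.mult subalg.gen; simp)+
  ultimately show "{T1, inverse T1, T2, inverse T2, T3, inverse T3, T4, inverse T4, T5, inverse T5, T6, inverse T6}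
    \<subseteq> subalg ?G"
    by (auto intro: subalg.gen)
qed

lemma alg_R3_subset: "alg_R3 \<subseteq> laurent_algebra {Omega1, Omega2}"
  unfolding alg_R3_def laurent_algebra_def
proof (rule subalg_subset)
  let ?G = "{Omega1, Omega2} \<union>
    {T3, inverse T3, T4, inverse T4, T5, inverse T5, T6, inverse T6} :: 'a ratfun6 set"
  have "T1 \<in> subalg ?G" "T2 \<in> subalg ?G"
    unfolding T1_eq T2_eq by (intro subalg.mult subalg.gen; simp)+
  then show "{T1, T2, T3, inverse T3, T4, inverse T4, T5, inverse T5, T6, inverse T6} \<subseteq> subalg ?G"
    by (auto intro: subalg.gen)
qed

text \<open>
  Each step of the construction of the \<open>T\<^sub>i\<close> is triangular: it changes an element by an expression in
  elements with larger index, and the denominators \<open>X\<^sub>6\<close>, \<open>X\<^sub>5\<close>, \<open>X\<^sub>4\<^sub>5\<close>, \<open>X\<^sub>3\<^sub>4\<close> are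
  \<open>T\<^sub>6\<close>, \<open>T\<^sub>5\<close>, \<open>T\<^sub>4\<close>, \<open>T\<^sub>3\<close>. So the steps can be undone in reverse order.
\<close>

lemma alg_A_subset_alg_R3: "alg_A \<subseteq> (alg_R3 :: 'k::field_char_0 ratfun6 set)"
proof -
  let ?G = "{T1, T2, T3, inverse T3, T4, inverse T4, T5, inverse T5, T6, inverse T6} :: 'k ratfun6 set"
  note closed = subalg_intros[where S = ?G]
  have gens: "T1 \<in> subalg ?G" "T2 \<in> subalg ?G" "T3 \<in> subalg ?G" "inverse T3 \<in> subalg ?G"
    "T4 \<in> subalg ?G" "inverse T4 \<in> subalg ?G" "T5 \<in> subalg ?G" "inverse T5 \<in> subalg ?G"
    "T6 \<in> subalg ?G" "inverse T6 \<in> subalg ?G"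
    by (auto intro: subalg.gen)
  have 5: "X 5 = (T5 :: 'k ratfun6)" and 6: "X 6 = (T6 :: 'k ratfun6)"
    by (simp_all add: T5_def T6_def)
  have eqX36: "X36 = T3 + 3/2 * T4 * inverse (T5 :: 'k ratfun6)"
    by (simp add: T3_def T4_def T5_def X35_def X56_def)
  have X36: "X36 \<in> subalg ?G" unfolding eqX36 by (intro closed gens)
  have eqX25: "X25 = T2 + 2/3 * T3 ^ 3 * inverse (T4 :: 'k ratfun6)"
    by (simp add: T2_def X24_def T3_def T4_def X45_def)
  have X25: "X25 \<in> subalg ?G" unfolding eqX25 by (intro closed gens)
  have eqX15: "X15 = T1 + 1/2 * T2 * inverse T3 + 1/3 * T3 ^ 2 * inverse (T4 :: 'k ratfun6)"
    by (simp add: T1_def X13_def X14_def X34_def T2_def T3_def T4_def X45_def)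
  have X15: "X15 \<in> subalg ?G" unfolding eqX15 by (intro closed gens)
  have eqX26: "X26 = X25 + 3 * X36 ^ 2 * inverse T5 - 9/2 * X36 * T4 * inverse T5 ^ 2
      + 9/4 * T4 ^ 2 * inverse (T5 :: 'k ratfun6) ^ 3"
    by (simp add: X25_def X56_def T4_def T5_def power_inverse)
  have X26: "X26 \<in> subalg ?G" unfolding eqX26 by (intro closed gens X25 X36)
  have eqX16: "X16 = X15 + X36 * inverse T5 - 3/4 * T4 * inverse (T5 :: 'k ratfun6) ^ 2"
    by (simp add: X15_def X56_def T4_def T5_def power_inverse)
  have X16: "X16 \<in> subalg ?G" unfolding eqX16 by (intro closed gens X15 X36)
  have eqX4: "X 4 = T4 + 2/3 * T5 ^ 3 * inverse (T6 :: 'k ratfun6)"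
    by (simp add: T4_def X46_def T5_def T6_def)
  have 4: "X 4 \<in> subalg ?G" unfolding eqX4 by (intro closed gens)
  have eqX3: "X 3 = X36 + T5 ^ 2 * inverse (T6 :: 'k ratfun6)"
    by (simp add: X36_def T5_def T6_def)
  have 3: "X 3 \<in> subalg ?G" unfolding eqX3 by (intro closed gens X36)
  have eqX2: "X 2 = X26 - 3/2 * X 4 * inverse T6 + 3 * X 3 * T5 * inverse T6
      - T5 ^ 3 * inverse (T6 :: 'k ratfun6) ^ 2"
    by (simp add: X26_def T5_def T6_def power_inverse)
  have 2: "X 2 \<in> subalg ?G" unfolding eqX2 by (intro closed gens X26 3 4)
  have eqX1: "X 1 = X16 + 1/2 * T5 * inverse (T6 :: 'k ratfun6)"
    by (simp add: X16_def T5_def T6_def)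
  have 1: "X 1 \<in> subalg ?G" unfolding eqX1 by (intro closed gens X16)
  have "X i \<in> subalg ?G" for i
    using six_cases[of i] 1 2 3 4 gens(7,9) 5 6 by metis
  then show ?thesis
    unfolding alg_A_eq_subalg alg_R3_def by (intro subalg_subset) blast
qed

lemma alg_Abar_subset_alg_R3: "alg_Abar \<subseteq> alg_R3"
  unfolding alg_Abar_def alg_R3_def by (rule subalg_subset) (auto intro: subalg.gen)

lemma Omega_in_alg_Abar: "Omega1 \<in> alg_Abar" "Omega2 \<in> alg_Abar"
  unfolding alg_Abar_def Omega1_def Omega2_def by (intro subalg.mult subalg.gen; simp)+

lemma Omega_in_alg_R1:
  "Omega1 \<in> alg_R1" "inverse Omega1 \<in> alg_R1" "Omega2 \<in> alg_R1" "inverse Omega2 \<in> alg_R1"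
  unfolding alg_R1_def Omega1_def Omega2_def inverse_mult_distrib
  by (intro subalg.mult subalg.gen; simp)+

lemma Omega_in_alg_R3: "Omega1 \<in> alg_R3" "Omega2 \<in> alg_R3"
  using Omega_in_alg_Abar alg_Abar_subset_alg_R3 by blast+

lemma Omega_in_alg_A: "Omega1 \<in> alg_A" "Omega2 \<in> alg_A"
  unfolding alg_A_eq_subalg Omega1_eq Omega2_eq
  by (intro subalg_intros subalg.gen rangeI)+

lemma T_in_algebras: "{T3, T4, T5, T6} \<subseteq> alg_R1" "{T3, T4, T5, T6} \<subseteq> alg_R3" "{T3, T4, T5, T6} \<subseteq> alg_Abar"
  unfolding alg_R1_def alg_R3_def alg_Abar_def by (auto intro: subalg.gen)

lemma algebras_closed: "subalg alg_R1 \<subseteq> alg_R1" "subalg alg_R3 \<subseteq> alg_R3"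
  "subalg alg_Abar \<subseteq> alg_Abar" "subalg alg_A \<subseteq> alg_A"
  unfolding alg_R1_def alg_R3_def alg_Abar_def alg_A_eq_subalg by (rule subalg_idem)+

lemma poisson_centreD: "f \<in> poisson_centre A \<Longrightarrow> T \<subseteq> A \<Longrightarrow> t \<in> T \<Longrightarrow> pbr f t = 0"
  by (auto simp: poisson_centre_def)

lemma inverse_Omega_central: "pbr (inverse Omega1) f = 0" "pbr (inverse Omega2) f = 0"
  by (cases "Omega1 = (0 :: 'a ratfun6)"; cases "Omega2 = (0 :: 'a ratfun6)";
      simp add: pbr_inverse_left Omega1_central Omega2_central)+

theorem lemma3p5:
  shows "poisson_centre (alg_R1 :: 'k::field_char_0 ratfun6 set)
        = subalg {Omega1, inverse Omega1, Omega2, inverse Omega2}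
    \<and> poisson_centre (alg_Abar :: 'k ratfun6 set) = subalg {Omega1, Omega2}
    \<and> poisson_centre (alg_R3 :: 'k ratfun6 set) = subalg {Omega1, Omega2}
    \<and> poisson_centre (alg_A :: 'k ratfun6 set) = subalg {Omega1, Omega2}"
proof (intro conjI)
  have central: "pbr s f = 0" if "s \<in> {Omega1, Omega2}" for s f :: "'k ratfun6"
    using that Omega1_central Omega2_central by auto
  have central': "pbr s f = 0" if "s \<in> {Omega1, inverse Omega1, Omega2, inverse Omega2}"
    for s f :: "'k ratfun6"
    using that Omega1_central Omega2_central inverse_Omega_central by auto
  show "poisson_centre (alg_R1 :: 'k ratfun6 set) = subalg {Omega1, inverse Omega1, Omega2, inverse Omega2}"
    by (rule poisson_centre_eq_subalg[OF alg_R1_subset _ algebras_closed(1) central'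
          poisson_centreD[OF _ T_in_algebras(1)]])
      (simp_all add: Omega_in_alg_R1)
  show "poisson_centre (alg_Abar :: 'k ratfun6 set) = subalg {Omega1, Omega2}"
    by (rule poisson_centre_eq_subalg[OF order_trans[OF alg_Abar_subset_alg_R3 alg_R3_subset] _
          algebras_closed(3) central poisson_centreD[OF _ T_in_algebras(3)]])
      (simp_all add: Omega_in_alg_Abar)
  show "poisson_centre (alg_R3 :: 'k ratfun6 set) = subalg {Omega1, Omega2}"
    by (rule poisson_centre_eq_subalg[OF alg_R3_subset _ algebras_closed(2) central
          poisson_centreD[OF _ T_in_algebras(2)]])
      (simp_all add: Omega_in_alg_R3)
  \<comment> \<open>\<open>T\<^sub>3\<close> and \<open>T\<^sub>4\<close> are not polynomials, but commuting with the variables suffices.\<close>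
  have commute: "pbr f t = 0" if "f \<in> poisson_centre alg_A" for f t :: "'k ratfun6"
  proof (rule pbr_eq_0I)
    show "pbr f (X i) = 0" for i
      using that by (simp add: poisson_centre_def alg_A_eq_subalg subalg.gen)
  qed
  show "poisson_centre (alg_A :: 'k ratfun6 set) = subalg {Omega1, Omega2}"
    by (rule poisson_centre_eq_subalg[OF order_trans[OF alg_A_subset_alg_R3 alg_R3_subset] _
          algebras_closed(4) central commute])
      (simp_all add: Omega_in_alg_A)
qed

end
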